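(* Let $(X,d)$ be a compact extended Ptolemy metric space such that any three points of $X$ lie on a circle in $X$. Then through any three distinct points of $X$ there exists a unique circle in $X$.
   Context: An extended metric on a set $X$ (with at least two points) is a map $d:X\times X\to[0,\infty]$ such that for some subset $\Omega(d)$ with at most one element, $d$ is a finite metric on $X\setminus\Omega(d)$, $d(x,\omega)=\infty$ for $x\notin\Omega(d)$, $\omega\in\Omega(d)$, and $d(\omega,\omega)=0$ (the point $\omega$ is written $\infty$). The topology has basis the open balls around points of $X\setminus\Omega(d)$ and the complements of closed balls; compactness refers to this topology. In product-of-distances expressions in which a single point equals $\infty$, factors involving $\infty$ are cancelled. $(X,d)$ is Ptolemy if $d(x,y)d(z,w)\le d(x,z)d(y,w)+d(x,w)d(y,z)$ for all quadruples. A circle in $X$ is a subset $\sigma$ homeomorphic to $S^1$ such that for all distinct $x,y,z,w\in\sigma$ with $y,w$ in different components of $\sigma\setminus\{x,z\}$, $d(x,z)d(y,w)=d(x,y)d(z,w)+d(x,w)d(y,z)$. *)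

theory Defs
  imports "HOL-Analysis.Analysis" "HOL-Library.Extended_Nonnegative_Real"
begin

definition ext_metric :: "'a set \<Rightarrow> ('a \<Rightarrow> 'a \<Rightarrow> ennreal) \<Rightarrow> 'a set \<Rightarrow> bool" where
  "ext_metric X d \<Omega> \<longleftrightarrow>
     (\<exists>a\<in>X. \<exists>b\<in>X. a \<noteq> b) \<and>
     \<Omega> \<subseteq> X \<and> (\<forall>p\<in>\<Omega>. \<forall>q\<in>\<Omega>. p = q) \<and>
     (\<forall>x\<in>X - \<Omega>. \<forall>y\<in>X - \<Omega>. d x y < \<infinity>) \<and>
     (\<forall>x\<in>X - \<Omega>. \<forall>y\<in>X - \<Omega>. d x y = 0 \<longleftrightarrow> x = y) \<and>
     (\<forall>x\<in>X - \<Omega>. \<forall>y\<in>X - \<Omega>. d x y = d y x) \<and>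
     (\<forall>x\<in>X - \<Omega>. \<forall>y\<in>X - \<Omega>. \<forall>z\<in>X - \<Omega>. d x z \<le> d x y + d y z) \<and>
     (\<forall>x\<in>X - \<Omega>. \<forall>w\<in>\<Omega>. d x w = \<infinity> \<and> d w x = \<infinity>) \<and>
     (\<forall>w\<in>\<Omega>. d w w = 0)"

definition emtop :: "'a set \<Rightarrow> ('a \<Rightarrow> 'a \<Rightarrow> ennreal) \<Rightarrow> 'a set \<Rightarrow> 'a topology" where
  "emtop X d \<Omega> = topology_generated_by
     ({{y\<in>X. d x y < ennreal r} | x r. x \<in> X - \<Omega> \<and> r > 0} \<union>
      {X - {y\<in>X. d x y \<le> ennreal r} | x r. x \<in> X - \<Omega> \<and> r \<ge> 0})"

text \<open>Product d(a,b) d(c,e) inside an expression on the four points a,b,c,e: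
  if exactly one of the four points is the point at infinity, the factor
  involving it is cancelled; otherwise the ordinary product in [0,\<infinity>].\<close>

definition pprod :: "('a \<Rightarrow> 'a \<Rightarrow> ennreal) \<Rightarrow> 'a set \<Rightarrow> 'a \<Rightarrow> 'a \<Rightarrow> 'a \<Rightarrow> 'a \<Rightarrow> ennreal" where
  "pprod d \<Omega> a b c e =
     (if length (filter (\<lambda>p. p \<in> \<Omega>) [a, b, c, e]) = 1
      then (if a \<in> \<Omega> \<or> b \<in> \<Omega> then d c e else d a b)
      else d a b * d c e)"

definition ptolemy :: "'a set \<Rightarrow> ('a \<Rightarrow> 'a \<Rightarrow> ennreal) \<Rightarrow> 'a set \<Rightarrow> bool" where
  "ptolemy X d \<Omega> \<longleftrightarrow> (\<forall>x\<in>X. \<forall>y\<in>X. \<forall>z\<in>X. \<forall>w\<in>X.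
     pprod d \<Omega> x y z w \<le> pprod d \<Omega> x z y w + pprod d \<Omega> x w y z)"

definition is_circle :: "'a set \<Rightarrow> ('a \<Rightarrow> 'a \<Rightarrow> ennreal) \<Rightarrow> 'a set \<Rightarrow> 'a set \<Rightarrow> bool" where
  "is_circle X d \<Omega> \<sigma> \<longleftrightarrow> \<sigma> \<subseteq> X \<and>
     (subtopology (emtop X d \<Omega>) \<sigma>) homeomorphic_space
       (top_of_set (sphere (0::real^2) 1)) \<and>
     (\<forall>x\<in>\<sigma>. \<forall>y\<in>\<sigma>. \<forall>z\<in>\<sigma>. \<forall>w\<in>\<sigma>. distinct [x, y, z, w] \<longrightarrow>
        \<not> (\<exists>C\<in>connected_components_of (subtopology (emtop X d \<Omega>) (\<sigma> - {x, z})).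
              y \<in> C \<and> w \<in> C) \<longrightarrow>
        pprod d \<Omega> x z y w = pprod d \<Omega> x y z w + pprod d \<Omega> x w y z)"

end

theory Submission
  imports Defs
begin

text \<open>Inverting at a point \<open>p\<close> of a circle turns \<open>X - {p}\<close> into a Ptolemaic metric space in which the
  rest of the circle is a geodesic line and any two points are joined by a geodesic. A fourth
  point of the circle is separated by two of the three given points from the third one; inverting
  at the latter, it suffices that geodesics in this separable Ptolemaic space are unique.

  Distance functions are convex along a geodesic \<open>l\<close>, so each has only countably many kinks. By
  Ptolemy, the size of the kink at \<open>l s\<close> of the distance from \<open>w\<close> depends continuously on
  \<open>w \<noteq> l s\<close>; hence, by separability, for all but countably many \<open>s\<close> no distance function has a
  kink at \<open>l s\<close>. But if a geodesic \<open>m\<close> with the same ends differs from \<open>l\<close> at \<open>s\<close>, hence on an open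
  interval around \<open>s\<close>, then the distance from the midpoint of \<open>l s\<close> and \<open>m s\<close> does have a kink at
  \<open>l s\<close>.\<close>

section \<open>Kinks of convex functions\<close>

text \<open>For convex \<open>f\<close> this says that the right derivative at \<open>s\<close>
  exceeds the left derivative by at least some \<open>K > 0\<close>. The symmetric second difference
  expresses this without one-sided derivatives and adds well with Ptolemy inequalities.\<close>

definition kinked :: "(real \<Rightarrow> real) \<Rightarrow> real \<Rightarrow> bool" where
  "kinked f s \<longleftrightarrow>
     (\<exists>K>0. \<exists>r>0. \<forall>h. 0 < h \<and> h < r \<longrightarrow> f (s + h) + f (s - h) - 2 * f s \<ge> K * h)"

text \<open>At a kink the secant slopes to the left of \<open>s\<close> and those to the right leave
  a gap of length at least \<open>K\<close>. A rational \<open>q\<close> inside the gap is the slope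
  of a line that touches the graph at \<open>s\<close> only.\<close>

lemma kinked_convex_imp_strict_minimum:
  assumes f: "convex_on {a..b} f" and s: "s \<in> {a<..<b}" and kink: "kinked f s"
  obtains q where "q \<in> \<rat>" "\<And>t. t \<in> {a..b} \<Longrightarrow> t \<noteq> s \<Longrightarrow> f s - q * s < f t - q * t"
proof -
  define sl where "sl t = (f t - f s) / (t - s)" for t
  obtain K r where K: "K > 0" and r: "r > 0"
    and Kr: "\<And>h. 0 < h \<Longrightarrow> h < r \<Longrightarrow> f (s + h) + f (s - h) - 2 * f s \<ge> K * h"
    using kink unfolding kinked_def by blast
  \<comment> \<open>Secant slopes of a convex function increase, so it suffices to compare the
    slopes at \<open>s - h\<close> and \<open>s + h\<close> for an \<open>h\<close> smaller than
    \<open>r\<close> and than both distances; there the kink gives the gap directly.\<close>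
  have gap: "sl t + K \<le> sl u" if t: "a \<le> t" "t < s" and u: "s < u" "u \<le> b" for t u
  proof -
    define h where "h = min (min (s - t) (u - s)) r / 2"
    have h: "h > 0" "h < r" "h < s - t" "h < u - s"
      using t u r by (auto simp: h_def min_def)
    have "sl t \<le> sl (s - h)"
      using convex_on_slope_le(2)[OF f, of t s "s - h"] h t s by (simp add: sl_def)
    moreover have "sl (s + h) \<le> sl u"
      using convex_on_slope_le(1)[OF f, of s u "s + h"] h u s
      by (simp add: sl_def) (smt (verit) minus_divide_divide minus_diff_eq divide_minus_left divide_minus_right minus_divide_left)
    moreover have "sl (s - h) + K \<le> sl (s + h)"
    proof -
      have "sl (s - h) = (f s - f (s - h)) / h" "sl (s + h) = (f (s + h) - f s) / h"
        using h(1) by (simp_all add: sl_def field_simps)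
      moreover have "(f s - f (s - h)) / h + K \<le> (f (s + h) - f s) / h"
      proof -
        have "K \<le> (f (s + h) + f (s - h) - 2 * f s) / h"
          using Kr[OF h(1,2)] h(1) by (simp add: pos_le_divide_eq)
        then show ?thesis by (simp add: diff_divide_distrib add_divide_distrib)
      qed
      ultimately show ?thesis by simp
    qed
    ultimately show ?thesis by linarith
  qed
  \<comment> \<open>\<open>L\<close> is the left derivative at \<open>s\<close>, so that
    \<open>L\<close> and \<open>L + K\<close> bound the gap.\<close>
  define L where "L = Sup (sl ` {a..<s})"
  have bdd: "bdd_above (sl ` {a..<s})"
    using gap[of _ b] K s by (intro bdd_aboveI2[where M = "sl b"]) fastforce
  have left: "sl t \<le> L" if "a \<le> t" "t < s" for t
    unfolding L_def using that bdd by (intro cSup_upper) auto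
  have right: "L + K \<le> sl u" if "s < u" "u \<le> b" for u
  proof -
    have "L \<le> sl u - K"
      unfolding L_def using gap that s by (intro cSup_least) (fastforce simp: algebra_simps)+
    then show ?thesis by simp
  qed
  obtain q where q: "q \<in> \<rat>" "L < q" "q < L + K"
    using Rats_dense_in_real[of L "L + K"] K by auto
  have "f s - q * s < f t - q * t" if t: "t \<in> {a..b}" "t \<noteq> s" for t
  proof (cases "t < s")
    case True
    then have "sl t < q" using left[of t] q t by auto
    then show ?thesis using True by (simp add: sl_def field_simps)
  next
    case False
    then have "q < sl t" "s < t" using right[of t] q t by auto
    then show ?thesis by (simp add: sl_def field_simps)
  qed
  then show ?thesis using that q by blast
qed

lemma countable_kinks:
  assumes "convex_on {a..b} f"
  shows "countable {s \<in> {a<..<b}. kinked f s}"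
proof -
  \<comment> \<open>\<open>m q\<close> has at most one element, since of two strict minimisers each
    would have the smaller value. The kinks are thus indexed by rationals.\<close>
  define m where "m q = {s \<in> {a<..<b}. \<forall>t\<in>{a..b} - {s}. f s - q * s < f t - q * t}" for q
  have "{s \<in> {a<..<b}. kinked f s} \<subseteq> (\<Union>q\<in>\<rat>. m q)"
  proof clarify
    fix s assume s: "s \<in> {a<..<b}" "kinked f s"
    obtain q where "q \<in> \<rat>" "\<And>t. t \<in> {a..b} \<Longrightarrow> t \<noteq> s \<Longrightarrow> f s - q * s < f t - q * t"
      using kinked_convex_imp_strict_minimum[OF assms s] by metis
    then have "q \<in> \<rat>" "s \<in> m q" using s unfolding m_def by blast+
    then show "s \<in> (\<Union>q\<in>\<rat>. m q)" by blast
  qed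
  moreover have "countable (m q)" for q
  proof -
    have "s = t" if "s \<in> m q" "t \<in> m q" for s t
    proof (rule ccontr)
      assume "s \<noteq> t"
      with that have "f s - q * s < f t - q * t" "f t - q * t < f s - q * s"
        by (auto simp: m_def)
      then show False by simp
    qed
    then have "m q \<subseteq> {SOME s. s \<in> m q}"
      by (metis (full_types) singletonI someI subsetI)
    then show ?thesis
      using countable_subset by blast
  qed
  ultimately show ?thesis
    using countable_UN[OF countable_rat, of m] countable_subset by blast
qed

section \<open>Ptolemaic metric spaces\<close>

locale ptolemaic_space = Metric_space M d for M :: "'a set" and d +
  assumes ptolemaic: "\<lbrakk>x \<in> M; y \<in> M; z \<in> M; w \<in> M\<rbrakk>
    \<Longrightarrow> d x y * d z w \<le> d x z * d y w + d x w * d y z"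
begin

text \<open>A geodesic parametrised by arc length. Only the values of \<open>l\<close> on
  \<open>{0..L}\<close> matter.\<close>

definition arc_between :: "(real \<Rightarrow> 'a) \<Rightarrow> real \<Rightarrow> 'a \<Rightarrow> 'a \<Rightarrow> bool" where
  "arc_between l L x y \<longleftrightarrow> 0 \<le> L \<and> l ` {0..L} \<subseteq> M \<and> l 0 = x \<and> l L = y \<and>
     (\<forall>s\<in>{0..L}. \<forall>t\<in>{0..L}. d (l s) (l t) = \<bar>s - t\<bar>)"

section \<open>Reversing and joining geodesics\<close>

lemma arc_between_reverse:
  assumes "arc_between l L x y"
  shows "arc_between (\<lambda>t. l (L - t)) L y x"
  using assms unfolding arc_between_def by (auto simp: image_subset_iff abs_minus_commute)

lemma arc_between_join:
  assumes l: "arc_between l L x y" and m: "arc_between m K y z" and eq: "d x z = L + K"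
  shows "arc_between (\<lambda>t. if t \<le> L then l t else m (t - L)) (L + K) x z"
proof -
  have LK: "0 \<le> L" "0 \<le> K" and e: "l 0 = x" "l L = y" "m 0 = y" "m K = z"
    and lM: "\<And>t. t \<in> {0..L} \<Longrightarrow> l t \<in> M" and mM: "\<And>t. t \<in> {0..K} \<Longrightarrow> m t \<in> M"
    and dl: "\<And>s t. s \<in> {0..L} \<Longrightarrow> t \<in> {0..L} \<Longrightarrow> d (l s) (l t) = \<bar>s - t\<bar>"
    and dm: "\<And>s t. s \<in> {0..K} \<Longrightarrow> t \<in> {0..K} \<Longrightarrow> d (m s) (m t) = \<bar>s - t\<bar>"
    using l m by (auto simp: arc_between_def)
  have M: "x \<in> M" "y \<in> M" "z \<in> M"
    using lM[of 0] lM[of L] mM[of K] LK e by auto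
  \<comment> \<open>The path through \<open>y\<close> gives the upper bound. The lower bound holds
    because a shortcut from \<open>l s\<close> to \<open>m t\<close> would make \<open>x\<close> and
    \<open>z\<close> closer than \<open>L + K\<close>.\<close>
  have cross: "d (l s) (m t) = L - s + t" if "s \<in> {0..L}" "t \<in> {0..K}" for s t
  proof -
    have "d (l s) (m t) \<le> d (l s) y + d y (m t)"
      using triangle lM mM M that by blast
    moreover have "d x z \<le> d x (l s) + (d (l s) (m t) + d (m t) z)"
      using triangle[of x "l s" z] triangle[of "l s" "m t" z] lM mM M that by fastforce
    moreover have "d (l s) y = L - s" "d x (l s) = s" "d y (m t) = t" "d (m t) z = K - t"
      using dl[of s L] dl[of 0 s] dm[of 0 t] dm[of t K] that LK e by auto
    ultimately show ?thesis using eq by linarith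
  qed
  show ?thesis
    unfolding arc_between_def
  proof (intro conjI ballI)
    show "(if L + K \<le> L then l (L + K) else m (L + K - L)) = z"
      using e LK by (cases "K = 0") auto
    show "(\<lambda>t. if t \<le> L then l t else m (t - L)) ` {0..L + K} \<subseteq> M"
      using lM mM by (auto simp: image_subset_iff)
    fix s t assume st: "s \<in> {0..L + K}" "t \<in> {0..L + K}"
    show "d (if s \<le> L then l s else m (s - L)) (if t \<le> L then l t else m (t - L)) = \<bar>s - t\<bar>"
      using st dl[of s t] dm[of "s - L" "t - L"] cross[of s "t - L"] cross[of t "s - L"]
      by (auto simp: commute[of "m _" "l _"])
  qed (use e LK in auto)
qed

text \<open>Ptolemy for \<open>z\<close> and three points of a geodesic is the convexity inequality
  multiplied by the length of the parameter interval, because distances along the geodesic are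
  parameter differences.\<close>

lemma convex_dist_arc:
  assumes l: "arc_between l L x y" and z: "z \<in> M"
  shows "convex_on {0..L} (\<lambda>t. d z (l t))"
proof (rule convex_on_linorderI)
  fix t u v :: real
  assume t: "0 < t" "t < 1" and uv: "u \<in> {0..L}" "v \<in> {0..L}" "u < v"
  define w where "w = (1 - t) * u + t * v"
  have uw: "w - u = t * (v - u)" and wv: "v - w = (1 - t) * (v - u)"
    by (simp_all add: w_def algebra_simps)
  have "w - u > 0" "v - w > 0"
    unfolding uw wv using t uv by simp_all
  then have w: "w \<in> {0..L}" "u < w" "w < v"
    using uv by auto
  have "d z (l w) * d (l u) (l v) \<le> d z (l u) * d (l w) (l v) + d z (l v) * d (l w) (l u)"
    using l z w uv by (intro ptolemaic) (auto simp: arc_between_def)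
  moreover have "d (l u) (l v) = v - u" "d (l w) (l v) = v - w" "d (l w) (l u) = w - u"
    using l w uv unfolding arc_between_def by auto
  ultimately have "(v - u) * d z (l w) \<le> (v - u) * ((1 - t) * d z (l u) + t * d z (l v))"
    unfolding uw wv by (simp add: algebra_simps)
  then show "d z (l ((1 - t) *\<^sub>R u + t *\<^sub>R v)) \<le> (1 - t) * d z (l u) + t * d z (l v)"
    using uv by (simp add: w_def)
qed simp

text \<open>By Ptolemy, the one-sided derivatives of \<open>d z (l t) / d z (l s)\<close> at \<open>t = s\<close> depend
  Lipschitz-continuously on \<open>z\<close>; hence kinks survive a small perturbation of \<open>z\<close>.\<close>

lemma kinked_dist_nearby:
  assumes l: "arc_between l L x y" and s: "s \<in> {0<..<L}"
    and w: "w \<in> M" "w \<noteq> l s" and kink: "kinked (\<lambda>t. d w (l t)) s"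
  obtains e where "e > 0" "\<And>z. z \<in> M \<Longrightarrow> d w z < e \<Longrightarrow> kinked (\<lambda>t. d z (l t)) s"
proof -
  obtain K r where K: "K > 0" and r: "r > 0"
    and Kr: "\<And>h. 0 < h \<Longrightarrow> h < r \<Longrightarrow> d w (l (s + h)) + d w (l (s - h)) - 2 * d w (l s) \<ge> K * h"
    using kink unfolding kinked_def by blast
  have ls: "l s \<in> M" using l s by (auto simp: arc_between_def)
  define A where "A = d w (l s)"
  have A: "A > 0" using w ls zero[of w "l s"] nonneg[of w "l s"] unfolding A_def by linarith
  \<comment> \<open>Chosen so that \<open>(K + 2) * e = K * A / 2\<close>: the perturbation then
    costs at most half of the kink constant.\<close>
  define e where "e = K * A / (2 * (K + 2))"
  have e: "e > 0" using A K by (simp add: e_def)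
  have "kinked (\<lambda>t. d z (l t)) s" if z: "z \<in> M" "d w z < e" for z
  proof -
    define r' where "r' = min r (min s (L - s))"
    define B where "B = d z (l s)"
    have AB: "A \<le> d w z + B" unfolding A_def B_def using triangle w z ls by blast
    have "d z (l (s + h)) + d z (l (s - h)) - 2 * d z (l s) \<ge> (K / 2) * h"
      if h: "0 < h" "h < r'" for h
    proof -
      \<comment> \<open>Ptolemy for \<open>w\<close>, \<open>l s\<close>, \<open>l t\<close>,
        \<open>z\<close> compares the two distance functions after cross-multiplication with their
        values \<open>A\<close> and \<open>B\<close> at \<open>s\<close>. Adding the cases
        \<open>t = s + h\<close> and \<open>t = s - h\<close> compares second differences.\<close>
      have P: "d w (l t) * B \<le> d z (l t) * A + h * d w z"
        if t: "t \<in> {0..L}" "\<bar>t - s\<bar> = h" for t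
      proof -
        have lt: "l t \<in> M" using l t by (auto simp: arc_between_def)
        have "d w (l t) * d z (l s) \<le> d w z * d (l t) (l s) + d w (l s) * d (l t) z"
          using w z lt ls by (intro ptolemaic)
        moreover have "d (l t) (l s) = h"
          using l s t by (auto simp: arc_between_def)
        ultimately show ?thesis by (simp add: A_def B_def commute algebra_simps)
      qed
      have "d w (l (s + h)) * B + d w (l (s - h)) * B
          \<le> (d z (l (s + h)) + d z (l (s - h))) * A + 2 * h * d w z"
        using P[of "s + h"] P[of "s - h"] h by (simp add: r'_def algebra_simps)
      moreover have "(2 * A + K * h) * B \<le> (d w (l (s + h)) + d w (l (s - h))) * B"
        using Kr[of h] h by (intro mult_right_mono) (auto simp: A_def B_def r'_def)
      ultimately have "(2 * A + K * h) * B
          \<le> (d z (l (s + h)) + d z (l (s - h))) * A + 2 * h * d w z"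
        by (simp add: algebra_simps)
      then have *: "h * (K * B - 2 * d w z)
          \<le> A * (d z (l (s + h)) + d z (l (s - h)) - 2 * B)"
        by (simp add: algebra_simps)
      \<comment> \<open>\<open>B\<close> is at least \<open>A - d w z\<close>, so the error terms
        together are at most \<open>(K + 2) * d w z\<close>.\<close>
      have "K * (A - d w z) - 2 * d w z \<le> K * B - 2 * d w z"
        using AB K by simp
      moreover have "(K + 2) * d w z \<le> (K + 2) * e"
        using K z by (intro mult_left_mono) auto
      moreover have "(K + 2) * e = K * A / 2"
        using K by (simp add: e_def field_simps)
      ultimately have "K / 2 * A \<le> K * B - 2 * d w z"
        by (simp add: algebra_simps)
      then have "h * (K / 2 * A) \<le> h * (K * B - 2 * d w z)"
        using h by (intro mult_left_mono) auto
      with * have "A * (K / 2 * h) \<le> A * (d z (l (s + h)) + d z (l (s - h)) - 2 * B)"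
        by (simp add: algebra_simps)
      then show ?thesis using A by (simp add: B_def)
    qed
    moreover have "r' > 0" using r s by (simp add: r'_def)
    ultimately show ?thesis
      unfolding kinked_def using K half_gt_zero by blast
  qed
  then show ?thesis using that e by blast
qed

text \<open>A kink of the distance from \<open>w\<close> is also a kink of the distance from a
  nearby point of the dense set \<open>Q\<close>, so countably many convex functions account for all
  kinks. The case \<open>w = l s\<close> must be excluded: the distance from \<open>l s\<close> has
  a kink at every \<open>s\<close>.\<close>

lemma countable_kinks_dist:
  assumes l: "arc_between l L x y"
    and Q: "countable Q" "Q \<subseteq> M" "\<And>w e. w \<in> M \<Longrightarrow> e > 0 \<Longrightarrow> \<exists>z\<in>Q. d w z < e"
  shows "countable {s \<in> {0<..<L}. \<exists>w\<in>M. w \<noteq> l s \<and> kinked (\<lambda>t. d w (l t)) s}"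
proof (rule countable_subset)
  show "{s \<in> {0<..<L}. \<exists>w\<in>M. w \<noteq> l s \<and> kinked (\<lambda>t. d w (l t)) s}
      \<subseteq> (\<Union>z\<in>Q. {s \<in> {0<..<L}. kinked (\<lambda>t. d z (l t)) s})"
  proof clarify
    fix s w assume "s \<in> {0<..<L}" "w \<in> M" "w \<noteq> l s" "kinked (\<lambda>t. d w (l t)) s"
    then show "s \<in> (\<Union>z\<in>Q. {s \<in> {0<..<L}. kinked (\<lambda>t. d z (l t)) s})"
      using kinked_dist_nearby[OF l, of s w] Q(2,3) by (smt (verit) UN_iff mem_Collect_eq subsetD)
  qed
  show "countable (\<Union>z\<in>Q. {s \<in> {0<..<L}. kinked (\<lambda>t. d z (l t)) s})"
    using Q(1,2) countable_kinks convex_dist_arc[OF l] by (intro countable_UN) auto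
qed

text \<open>The midpoint \<open>w\<close> has the same distances to \<open>x\<close> and \<open>y\<close> as \<open>l s\<close> and \<open>q\<close>, so Ptolemy for
  \<open>l t, w, q\<close> and either end bounds \<open>d w (l t)\<close> below by a convex function minus a tent with
  its peak at \<open>s\<close>, with equality at \<open>s\<close>.\<close>

lemma kinked_midpoint:
  assumes l: "arc_between l L x y" and s: "s \<in> {0<..<L}"
    and q: "q \<in> M" "q \<noteq> l s" "d x q = s" "d q y = L - s"
    and w: "w \<in> M" "d (l s) w = d (l s) q / 2" "d w q = d (l s) q / 2"
  shows "kinked (\<lambda>t. d w (l t)) s"
proof -
  define k where "k = d (l s) q / 2"
  have M: "x \<in> M" "y \<in> M" and lM: "\<And>t. t \<in> {0..L} \<Longrightarrow> l t \<in> M"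
    using l by (auto simp: arc_between_def)
  have ls: "l s \<in> M" using lM s by auto
  have "d (l s) q \<noteq> 0" using q ls by simp
  then have k: "k > 0" using nonneg[of "l s" q] unfolding k_def by linarith
  have dx: "d x (l t) = t" and dy: "d y (l t) = L - t" if "t \<in> {0..L}" for t
    using l that unfolding arc_between_def by auto
  have wk: "d (l s) q = 2 * k" "d w q = k" "d w (l s) = k"
    using w by (simp_all add: k_def commute)
  \<comment> \<open>Ptolemy for \<open>z\<close>, \<open>w\<close>, \<open>l s\<close>,
    \<open>q\<close>, divided by \<open>2 * k\<close>.\<close>
  have mid: "d z w \<le> (d z (l s) + d z q) / 2" if "z \<in> M" for z
  proof -
    have "d z w * d (l s) q \<le> d z (l s) * d w q + d z q * d w (l s)"
      using that q w ls by (intro ptolemaic)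
    then have "d z w * (2 * k) \<le> ((d z (l s) + d z q) / 2) * (2 * k)"
      using wk by (simp add: commute algebra_simps)
    then show ?thesis using k by simp
  qed
  \<comment> \<open>These two upper bounds add up to \<open>L\<close>, the distance from
    \<open>x\<close> to \<open>y\<close>, so the triangle inequality turns both into
    equalities.\<close>
  have "d x w \<le> s" "d y w \<le> L - s"
    using mid[of x] mid[of y] M dx dy s q by (auto simp: commute)
  moreover have "L \<le> d x w + d w y"
    using triangle[of x w y] M w dx[of L] l by (auto simp: arc_between_def)
  ultimately have dw: "d x w = s" "d y w = L - s"
    by (auto simp: commute)
  have lower: "d q (l t) - k * (t / s) \<le> d w (l t)"
    "d q (l t) - k * ((L - t) / (L - s)) \<le> d w (l t)" if t: "t \<in> {0..L}" for t
  proof -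
    have "d q (l t) * d w x \<le> d q w * d (l t) x + d q x * d (l t) w"
      using t q w M lM by (intro ptolemaic)
    then have "d q (l t) * s \<le> k * t + s * d w (l t)"
      using dw dx[OF t] q wk by (simp add: commute)
    then show "d q (l t) - k * (t / s) \<le> d w (l t)"
      using s by (simp add: field_simps)
    have "d q (l t) * d w y \<le> d q w * d (l t) y + d q y * d (l t) w"
      using t q w M lM by (intro ptolemaic)
    then have "d q (l t) * (L - s) \<le> k * (L - t) + (L - s) * d w (l t)"
      using dw dy[OF t] q wk by (simp add: commute)
    then show "d q (l t) - k * ((L - t) / (L - s)) \<le> d w (l t)"
      using s by (simp add: field_simps)
  qed
  have "d w (l (s + h)) + d w (l (s - h)) - 2 * d w (l s) \<ge> (k / s + k / (L - s)) * h"
    if h: "0 < h" "h < min s (L - s)" for h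
  proof -
    have I: "s + h \<in> {0..L}" "s - h \<in> {0..L}" using h by auto
    \<comment> \<open>Convexity of the distance from \<open>q\<close>, whose value at
      \<open>s\<close> is \<open>2 * k\<close>. Below, the tent is estimated on its descending side
      at \<open>s + h\<close> and on its ascending side at \<open>s - h\<close>; the constants
      cancel and the two slopes of the tent remain.\<close>
    have "d q (l s) \<le> (1 - 1 / 2) * d q (l (s - h)) + 1 / 2 * d q (l (s + h))"
      using convex_onD[OF convex_dist_arc[OF l q(1)], of "1 / 2" "s - h" "s + h"] I
      by (simp add: field_simps)
    then have "4 * k \<le> d q (l (s - h)) + d q (l (s + h))"
      by (simp add: k_def commute)
    moreover have "d w (l s) = k" using w by (simp add: k_def commute)
    moreover have "k * ((L - (s + h)) / (L - s)) = k - k / (L - s) * h"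
      "k * ((s - h) / s) = k - k / s * h"
      using s by (simp_all add: field_simps)
    ultimately show ?thesis
      using lower(2)[OF I(1)] lower(1)[OF I(2)] unfolding distrib_right by linarith
  qed
  moreover have "k / s + k / (L - s) > 0" "min s (L - s) > 0"
    using k s by (auto intro: add_pos_pos)
  ultimately show ?thesis
    unfolding kinked_def by blast
qed

text \<open>If the geodesics differ at \<open>s\<close>, they differ on an open interval. By
  \<open>kinked_midpoint\<close> every parameter of that interval is a kink of some distance
  function, but such kinks are countable in number.\<close>

theorem arc_between_unique:
  assumes Q: "countable Q" "Q \<subseteq> M" "\<And>w e. w \<in> M \<Longrightarrow> e > 0 \<Longrightarrow> \<exists>z\<in>Q. d w z < e"
    and mid: "\<And>p q. p \<in> M \<Longrightarrow> q \<in> M \<Longrightarrow> \<exists>w\<in>M. d p w = d p q / 2 \<and> d w q = d p q / 2"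
    and l: "arc_between l L x y" and m: "arc_between m L x y" and s: "s \<in> {0..L}"
  shows "l s = m s"
proof (rule ccontr)
  assume neq: "l s \<noteq> m s"
  have lM: "\<And>t. t \<in> {0..L} \<Longrightarrow> l t \<in> M" and mM: "\<And>t. t \<in> {0..L} \<Longrightarrow> m t \<in> M"
    using l m by (auto simp: arc_between_def)
  have "s \<noteq> 0" "s \<noteq> L" using neq l m by (auto simp: arc_between_def)
  then have s': "0 < s" "s < L" using s by auto
  \<comment> \<open>When the parameter moves by \<open>u\<close>, the distance between
    \<open>l\<close> and \<open>m\<close> changes by at most \<open>2 * u\<close>; hence half of
    that distance as a radius keeps them apart. The other term keeps the interval inside
    \<open>{0<..<L}\<close>.\<close>
  define r where "r = min (d (l s) (m s) / 2) (min s (L - s))"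
  have "d (l s) (m s) > 0"
    using neq zero[of "l s" "m s"] nonneg[of "l s" "m s"] lM[OF s] mM[OF s] by linarith
  then have r: "r > 0" using s' by (simp add: r_def)
  have "kinked (\<lambda>u. d w (l u)) t \<and> w \<noteq> l t"
    if t: "t \<in> {s - r<..<s + r}" and w: "w \<in> M" "d (l t) w = d (l t) (m t) / 2" "d w (m t) = d (l t) (m t) / 2" for t w
  proof -
    have tL: "t \<in> {0<..<L}" "t \<in> {0..L}" using t by (auto simp: r_def)
    have "r \<le> d (l s) (m s) / 2"
      unfolding r_def by (rule min.cobounded1)
    moreover have "\<bar>s - t\<bar> < r"
      using t by (simp add: abs_less_iff)
    ultimately have tr: "\<bar>s - t\<bar> < d (l s) (m s) / 2" by linarith
    have "d (l s) (m s) \<le> d (l s) (l t) + (d (l t) (m t) + d (m t) (m s))"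
      using triangle[of "l s" "l t" "m s"] triangle[of "l t" "m t" "m s"] lM mM s tL by fastforce
    moreover have "d (l s) (l t) = \<bar>s - t\<bar>" "d (m t) (m s) = \<bar>s - t\<bar>"
      using l m s tL unfolding arc_between_def by auto
    ultimately have pos: "d (l t) (m t) > 0" using tr by linarith
    then have "m t \<noteq> l t" using lM tL by auto
    moreover have "w \<noteq> l t" using pos w lM tL by auto
    moreover have "d x (m t) = t" "d (m t) y = L - t"
      using m tL unfolding arc_between_def by auto
    ultimately show ?thesis
      using kinked_midpoint[OF l tL(1) mM[OF tL(2)] _ _ _ w] by simp
  qed
  moreover have "\<exists>w\<in>M. d (l t) w = d (l t) (m t) / 2 \<and> d w (m t) = d (l t) (m t) / 2"
    if "t \<in> {s - r<..<s + r}" for t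
    using that by (intro mid lM mM) (auto simp: r_def)
  ultimately have "{s - r<..<s + r}
      \<subseteq> {s \<in> {0<..<L}. \<exists>w\<in>M. w \<noteq> l s \<and> kinked (\<lambda>t. d w (l t)) s}"
    by (fastforce simp: r_def)
  then have "countable {s - r<..<s + r}"
    using countable_kinks_dist[OF l Q] countable_subset by blast
  then show False
    using r uncountable_open_interval[of "s - r" "s + r"] by auto
qed

end

section \<open>Inversions of extended Ptolemaic spaces\<close>

locale extended_ptolemaic =
  fixes X :: "'a set" and d :: "'a \<Rightarrow> 'a \<Rightarrow> ennreal" and \<Omega> :: "'a set"
  assumes ext: "ext_metric X d \<Omega>" and pt: "ptolemy X d \<Omega>"
begin

text \<open>The value 1 at the point at infinity implements the cancellation of factors
  in \<^const>\<open>pprod\<close>.\<close>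

definition edist :: "'a \<Rightarrow> 'a \<Rightarrow> real" where
  "edist a b =
     (if a \<in> X \<and> b \<in> X \<and> a \<noteq> b then if a \<in> \<Omega> \<or> b \<in> \<Omega> then 1 else enn2real (d a b) else 0)"

text \<open>The metric inversion at \<open>p\<close>. For \<open>p\<close> at infinity it is the
  original metric, and the distance from the point at infinity to a finite \<open>b\<close> becomes
  \<open>1 / edist b p\<close>.\<close>

definition mdist :: "'a \<Rightarrow> 'a \<Rightarrow> 'a \<Rightarrow> real" where
  "mdist p a b = edist a b / (edist a p * edist b p)"

section \<open>Real-valued distances and the point at infinity\<close>

lemma infinity_unique: "a \<in> \<Omega> \<Longrightarrow> b \<in> \<Omega> \<Longrightarrow> a = b"
  using ext by (auto simp: ext_metric_def)

lemma ex_finite_point: obtains x where "x \<in> X - \<Omega>"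
proof -
  obtain a b where "a \<in> X" "b \<in> X" "a \<noteq> b"
    using ext by (auto simp: ext_metric_def)
  then show thesis using infinity_unique[of a b] that by blast
qed

lemma infinity_subset: "\<Omega> \<subseteq> X"
  using ext by (auto simp: ext_metric_def)

lemma dist_infinity: "a \<in> X - \<Omega> \<Longrightarrow> b \<in> \<Omega> \<Longrightarrow> d a b = \<infinity>"
  using ext by (auto simp: ext_metric_def)

lemma dist_eq_edist: "a \<in> X - \<Omega> \<Longrightarrow> b \<in> X - \<Omega> \<Longrightarrow> d a b = ennreal (edist a b)"
  using ext by (auto simp: ext_metric_def edist_def less_top)

lemma edist_nonneg [simp]: "0 \<le> edist a b"
  by (simp add: edist_def)

lemma edist_commute: "edist a b = edist b a"
  using ext by (auto simp: ext_metric_def edist_def)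

lemma edist_self [simp]: "edist a a = 0"
  by (simp add: edist_def)

lemma edist_infinity: "a \<in> X \<Longrightarrow> b \<in> \<Omega> \<Longrightarrow> a \<noteq> b \<Longrightarrow> edist a b = 1"
  using infinity_subset by (auto simp: edist_def)

lemma edist_pos: "a \<in> X \<Longrightarrow> b \<in> X \<Longrightarrow> a \<noteq> b \<Longrightarrow> 0 < edist a b"
  using ext by (auto simp: ext_metric_def edist_def enn2real_positive_iff less_top zero_less_iff_neq_zero)

lemma edist_triangle:
  assumes "a \<in> X - \<Omega>" "b \<in> X - \<Omega>" "c \<in> X - \<Omega>"
  shows "edist a c \<le> edist a b + edist b c"
proof -
  have "d a c \<le> d a b + d b c"
    using ext assms unfolding ext_metric_def by blast
  then show ?thesis
    using assms by (simp add: dist_eq_edist flip: ennreal_plus)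
qed

text \<open>At most one of four distinct points is infinite, and the factor 1 replaces the cancelled
  one. Distinctness matters: \<open>pprod\<close> counts infinite points with repetition and does
  not cancel for a repeated one.\<close>

lemma pprod_eq_edist:
  assumes "x \<in> X" "y \<in> X" "z \<in> X" "w \<in> X" "distinct [x, y, z, w]"
  shows "pprod d \<Omega> x y z w = ennreal (edist x y * edist z w)"
proof -
  have one: "\<And>a b. a \<in> \<Omega> \<Longrightarrow> a \<noteq> b \<Longrightarrow> b \<notin> \<Omega>"
    using infinity_unique by blast
  consider "x \<in> \<Omega>" | "y \<in> \<Omega>" | "z \<in> \<Omega>" | "w \<in> \<Omega>"
    | "x \<notin> \<Omega>" "y \<notin> \<Omega>" "z \<notin> \<Omega>" "w \<notin> \<Omega>"
    by blast
  then show ?thesis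
  proof cases
    case 1
    with assms one have "y \<notin> \<Omega>" "z \<notin> \<Omega>" "w \<notin> \<Omega>" by auto
    moreover have "edist x y = 1"
      using 1 assms edist_infinity[of y x] by (auto simp: edist_commute[of x])
    ultimately show ?thesis
      using 1 assms by (simp add: pprod_def dist_eq_edist)
  next
    case 2
    with assms one have "x \<notin> \<Omega>" "z \<notin> \<Omega>" "w \<notin> \<Omega>" by auto
    with 2 assms show ?thesis
      by (simp add: pprod_def dist_eq_edist edist_infinity)
  next
    case 3
    with assms one have "x \<notin> \<Omega>" "y \<notin> \<Omega>" "w \<notin> \<Omega>" by auto
    moreover have "edist z w = 1"
      using 3 assms edist_infinity[of w z] by (auto simp: edist_commute[of z])
    ultimately show ?thesis
      using 3 assms by (simp add: pprod_def dist_eq_edist)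
  next
    case 4
    with assms one have "x \<notin> \<Omega>" "y \<notin> \<Omega>" "z \<notin> \<Omega>" by auto
    with 4 assms show ?thesis
      by (simp add: pprod_def dist_eq_edist edist_infinity)
  next
    case 5
    with assms show ?thesis
      by (simp add: pprod_def dist_eq_edist ennreal_mult)
  qed
qed

lemma edist_ptolemy:
  assumes "x \<in> X" "y \<in> X" "z \<in> X" "w \<in> X"
  shows "edist x y * edist z w \<le> edist x z * edist y w + edist x w * edist y z"
proof (cases "distinct [x, y, z, w]")
  case True
  have "pprod d \<Omega> x y z w \<le> pprod d \<Omega> x z y w + pprod d \<Omega> x w y z"
    using pt assms unfolding ptolemy_def by blast
  then show ?thesis
    using assms True pprod_eq_edist[of x y z w] pprod_eq_edist[of x z y w] pprod_eq_edist[of x w y z]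
    by (auto simp flip: ennreal_plus)
next
  \<comment> \<open>With two equal points the left side is 0 or equals one of the summands on the
    right.\<close>
  case False
  then consider "x = y" | "z = w" | "x = z" | "x = w" | "y = z" | "y = w" by auto
  then show ?thesis
    by cases (simp_all add: edist_commute)
qed

text \<open>The triangle inequality after inversion is Ptolemy for the three points together with
  \<open>p\<close>. Ptolemy itself survives because all its products acquire the same denominator
  \<open>c\<close>.\<close>

lemma ptolemaic_space_mdist:
  assumes p: "p \<in> X"
  shows "ptolemaic_space (X - {p}) (mdist p)"
proof
  have pos: "0 < edist a p" if "a \<in> X - {p}" for a
    using edist_pos p that by auto
  show "0 \<le> mdist p x y" for x y by (simp add: mdist_def)
  show "mdist p x y = mdist p y x" for x y
    by (simp add: mdist_def edist_commute[of x y] mult.commute)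
  show "mdist p x y = 0 \<longleftrightarrow> x = y" if "x \<in> X - {p}" "y \<in> X - {p}" for x y
    using pos[OF that(1)] pos[OF that(2)] edist_pos[of x y] that
    by (cases "x = y") (auto simp: mdist_def)
  show "mdist p x z \<le> mdist p x y + mdist p y z"
    if "x \<in> X - {p}" "y \<in> X - {p}" "z \<in> X - {p}" for x y z
  proof -
    have "edist x z * edist y p \<le> edist x y * edist z p + edist x p * edist z y"
      using edist_ptolemy that p by blast
    then show ?thesis
      using pos[OF that(1)] pos[OF that(2)] pos[OF that(3)]
      by (simp add: mdist_def divide_simps edist_commute mult_ac)
  qed
  show "mdist p x y * mdist p z w \<le> mdist p x z * mdist p y w + mdist p x w * mdist p y z"
    if "x \<in> X - {p}" "y \<in> X - {p}" "z \<in> X - {p}" "w \<in> X - {p}" for x y z w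
  proof -
    define c where "c = edist x p * edist y p * edist z p * edist w p"
    have c: "c > 0" using pos that by (auto simp: c_def)
    have "(edist x y * edist z w) / c \<le> (edist x z * edist y w + edist x w * edist y z) / c"
      using edist_ptolemy that c by (intro divide_right_mono) auto
    then show ?thesis
      by (simp add: mdist_def c_def add_divide_distrib mult_ac)
  qed
qed

section \<open>Neighbourhoods in the topology of the extended metric\<close>

lemma openin_ball: "x \<in> X - \<Omega> \<Longrightarrow> r > 0 \<Longrightarrow> openin (emtop X d \<Omega>) {y\<in>X. d x y < ennreal r}"
  unfolding emtop_def by (intro topology_generated_by_Basis) blast

lemma openin_compl_cball:
  "x \<in> X - \<Omega> \<Longrightarrow> r \<ge> 0 \<Longrightarrow> openin (emtop X d \<Omega>) (X - {y\<in>X. d x y \<le> ennreal r})"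
  unfolding emtop_def by (intro topology_generated_by_Basis) blast

lemma mem_ball:
  assumes "x \<in> X - \<Omega>" "r > 0"
  shows "y \<in> {y\<in>X. d x y < ennreal r} \<longleftrightarrow> y \<in> X - \<Omega> \<and> edist x y < r"
  using assms dist_infinity[of x y] by (cases "y \<in> \<Omega>") (auto simp: dist_eq_edist ennreal_less_iff)

lemma mem_compl_cball:
  assumes "x \<in> X - \<Omega>" "r \<ge> 0"
  shows "y \<in> X - {y\<in>X. d x y \<le> ennreal r} \<longleftrightarrow> y \<in> X \<and> (y \<in> \<Omega> \<or> r < edist x y)"
  using assms dist_infinity[of x y] by (cases "y \<in> \<Omega>") (auto simp: dist_eq_edist top_unique)

lemma topspace_emtop: "topspace (emtop X d \<Omega>) = X"
proof
  show "topspace (emtop X d \<Omega>) \<subseteq> X"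
    unfolding emtop_def topology_generated_by_topspace by (intro Union_least) auto
  obtain x0 where x0: "x0 \<in> X - \<Omega>"
    by (rule ex_finite_point)
  show "X \<subseteq> topspace (emtop X d \<Omega>)"
  proof
    fix b assume b: "b \<in> X"
    show "b \<in> topspace (emtop X d \<Omega>)"
    proof (cases "b \<in> \<Omega>")
      case True
      then have "b \<in> X - {y\<in>X. d x0 y \<le> ennreal 0}" using mem_compl_cball[OF x0, of 0 b] b by simp
      then show ?thesis using openin_subset[OF openin_compl_cball[OF x0, of 0]] by auto
    next
      case False
      then have "b \<in> {y\<in>X. d b y < ennreal 1}" using mem_ball[of b 1 b] b by simp
      then show ?thesis using openin_subset[OF openin_ball[of b 1]] b False by auto
    qed
  qed
qed

text \<open>Balls of the inverted metric are neighbourhoods of their centres in the given topology,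
  apart from \<open>p\<close>. This transfers compactness and the continuity of circle
  parametrisations to \<open>mdist p\<close>.\<close>

lemma mdist_neighbourhood:
  assumes p: "p \<in> X" and b: "b \<in> X" "b \<noteq> p" and r: "r > 0"
  obtains U where "openin (emtop X d \<Omega>) U" "b \<in> U" "\<And>a. a \<in> U - {p} \<Longrightarrow> mdist p b a < r"
proof (cases "b \<in> \<Omega>")
  case True
  then have p': "p \<in> X - \<Omega>" using p b infinity_unique by blast
  \<comment> \<open>For infinite \<open>b\<close> the distance to \<open>a\<close> is
    \<open>1 / edist p a\<close>, which is small outside a large ball around
    \<open>p\<close>.\<close>
  define U where "U = X - {y\<in>X. d p y \<le> ennreal (1 / r)}"
  have U: "a \<in> U \<longleftrightarrow> a \<in> X \<and> (a \<in> \<Omega> \<or> 1 / r < edist p a)" for a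
    unfolding U_def using mem_compl_cball p' r by simp
  have "mdist p b a < r" if "a \<in> U - {p}" for a
  proof (cases "a = b")
    case True
    then show ?thesis using r by (simp add: mdist_def)
  next
    case False
    then have a: "a \<in> X" "1 / r < edist p a" using that True infinity_unique by (auto simp: U)
    have "edist b a = 1" "edist b p = 1"
      using edist_infinity[OF _ True] a b p False by (auto simp: edist_commute[of b])
    then have "mdist p b a = 1 / edist p a"
      by (simp add: mdist_def edist_commute)
    moreover have "0 < 1 / r" using r by simp
    then have "0 < edist p a" using a by linarith
    moreover have "1 / edist p a < r" if "0 < edist p a" using that a r by (simp add: field_simps)
    ultimately show ?thesis by simp
  qed
  moreover have "openin (emtop X d \<Omega>) U" unfolding U_def using openin_compl_cball p' r by simp
  ultimately show ?thesis using that[of U] U b True by blast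
next
  case False
  then have b': "b \<in> X - \<Omega>" using b by simp
  define c where "c = edist b p"
  have c: "c > 0" using edist_pos b p by (simp add: c_def)
  \<comment> \<open>For finite \<open>p\<close> the bound \<open>c / 2\<close> keeps
    \<open>a\<close> at distance more than \<open>c / 2\<close> from \<open>p\<close>, so the
    denominator is at least \<open>c * c / 2\<close>; the second bound then controls the
    quotient.\<close>
  define s where "s = (if p \<in> \<Omega> then r else min (c / 2) (r * c * c / 2))"
  have s: "s > 0" using c r by (simp add: s_def)
  define U where "U = {y\<in>X. d b y < ennreal s}"
  have U: "a \<in> U \<longleftrightarrow> a \<in> X - \<Omega> \<and> edist b a < s" for a
    unfolding U_def using mem_ball[OF b' s] by simp
  have "mdist p b a < r" if "a \<in> U - {p}" for a
  proof (cases "p \<in> \<Omega>")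
    case True
    have "a \<in> X" "a \<noteq> p" "edist b a < r" using that True U[of a] by (auto simp: s_def)
    then show ?thesis using edist_infinity[OF _ True] b by (simp add: mdist_def)
  next
    case False
    have a: "a \<in> X - \<Omega>" "edist b a < c / 2" "edist b a < r * c * c / 2"
      using that False by (auto simp: U s_def)
    have "c \<le> edist b a + edist a p"
      using edist_triangle a b' p False by (auto simp: c_def)
    then have ap: "c / 2 < edist a p" using a by linarith
    have "mdist p b a = edist b a / (c * edist a p)" by (simp add: mdist_def c_def)
    also have "\<dots> \<le> edist b a / (c * (c / 2))"
      using ap c by (intro divide_left_mono mult_left_mono mult_pos_pos) auto
    also have "\<dots> < r" using a c by (simp add: field_simps)
    finally show ?thesis .
  qed
  moreover have "openin (emtop X d \<Omega>) U" unfolding U_def using openin_ball b' s by simp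
  moreover have "b \<in> U" using U b' s by simp
  ultimately show ?thesis using that[of U] by blast
qed

text \<open>This exhausts \<open>X - {p}\<close> by the countably many closed sets
  \<open>X - V m\<close>: shrinking balls around a finite \<open>p\<close>, or complements of
  growing balls around a finite point if \<open>p\<close> is infinite.\<close>

lemma countable_neighbourhoods_Inter:
  assumes p: "p \<in> X"
  obtains V :: "nat \<Rightarrow> 'a set" where
    "\<And>m. openin (emtop X d \<Omega>) (V m)" "\<And>m. p \<in> V m" "(\<Inter>m. V m) = {p}"
proof (cases "p \<in> \<Omega>")
  case True
  obtain x0 where x0: "x0 \<in> X - \<Omega>"
    by (rule ex_finite_point)
  define V where "V m = X - {y\<in>X. d x0 y \<le> ennreal (real m)}" for m :: nat
  have V: "a \<in> V m \<longleftrightarrow> a \<in> X \<and> (a \<in> \<Omega> \<or> m < edist x0 a)" for a m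
    unfolding V_def using mem_compl_cball x0 by simp
  have "a = p" if "\<And>m. a \<in> V m" for a
  proof -
    obtain m :: nat where "edist x0 a < m" using reals_Archimedean2 by blast
    then have "a \<in> \<Omega>" using that[of m] by (auto simp: V)
    then show ?thesis using True infinity_unique by blast
  qed
  then have "(\<Inter>m. V m) = {p}" using True p V by auto
  then show ?thesis
    using that[of V] openin_compl_cball[OF x0] True p V by (auto simp: V_def)
next
  case False
  then have p': "p \<in> X - \<Omega>" using p by simp
  define V where "V m = {y\<in>X. d p y < ennreal (1 / real (Suc m))}" for m :: nat
  have V: "a \<in> V m \<longleftrightarrow> a \<in> X - \<Omega> \<and> edist p a < 1 / real (Suc m)" for a m
    unfolding V_def using mem_ball[OF p', of "1 / real (Suc m)"] by simp
  have "a = p" if "\<And>m. a \<in> V m" for a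
  proof (rule ccontr)
    assume "a \<noteq> p"
    then have "0 < edist p a" using edist_pos[of p a] p that[of 0] by (auto simp: V)
    then obtain m where "1 / real (Suc m) < edist p a"
      using nat_approx_posE by metis
    then show False using that[of m] by (auto simp: V)
  qed
  then have "(\<Inter>m. V m) = {p}" using p' V by auto
  moreover have "openin (emtop X d \<Omega>) (V m)" for m
    unfolding V_def using openin_ball[OF p'] by simp
  ultimately show ?thesis using that[of V] by blast
qed

text \<open>Although \<open>X - {p}\<close> need not be compact, compactness of \<open>X\<close>
  provides a finite \<open>1 / (n + 1)\<close>-net for each \<open>X - V m\<close>. The union of
  these nets over \<open>m\<close> and \<open>n\<close> is dense.\<close>

lemma separable_mdist:
  assumes comp: "compact_space (emtop X d \<Omega>)" and p: "p \<in> X"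
  obtains Q where "countable Q" "Q \<subseteq> X - {p}"
    "\<And>w e. w \<in> X - {p} \<Longrightarrow> e > 0 \<Longrightarrow> \<exists>z\<in>Q. mdist p w z < e"
proof -
  obtain V :: "nat \<Rightarrow> 'a set" where
    V: "\<And>m. openin (emtop X d \<Omega>) (V m)" "\<And>m. p \<in> V m" "(\<Inter>m. V m) = {p}"
    using countable_neighbourhoods_Inter[OF p] by metis
  have "\<exists>C. finite C \<and> C \<subseteq> X - {p} \<and>
      (\<forall>a\<in>X - {p} - V m. \<exists>c\<in>C. mdist p a c < 1 / real (Suc n))" for m n
  proof -
    have "\<forall>b\<in>X - {p}. \<exists>U. openin (emtop X d \<Omega>) U \<and> b \<in> U \<and>
        (\<forall>a\<in>U - {p}. mdist p b a < 1 / real (Suc n))"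
    proof
      fix b assume b: "b \<in> X - {p}"
      have "1 / real (Suc n) > 0" by simp
      then show "\<exists>U. openin (emtop X d \<Omega>) U \<and> b \<in> U \<and>
          (\<forall>a\<in>U - {p}. mdist p b a < 1 / real (Suc n))"
        using mdist_neighbourhood[OF p, of b "1 / real (Suc n)"] b by (metis DiffD1 DiffD2 singletonI)
    qed
    then obtain U where U: "\<And>b. b \<in> X - {p} \<Longrightarrow> openin (emtop X d \<Omega>) (U b)"
      "\<And>b. b \<in> X - {p} \<Longrightarrow> b \<in> U b"
      "\<And>a b. b \<in> X - {p} \<Longrightarrow> a \<in> U b - {p} \<Longrightarrow> mdist p b a < 1 / real (Suc n)"
      by metis
    obtain F where F: "finite F" "F \<subseteq> insert (V m) (U ` (X - {p}))" "X \<subseteq> \<Union>F"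
    proof -
      have "\<exists>F. finite F \<and> F \<subseteq> insert (V m) (U ` (X - {p})) \<and> topspace (emtop X d \<Omega>) \<subseteq> \<Union>F"
      proof (rule compactinD)
        show "compactin (emtop X d \<Omega>) (topspace (emtop X d \<Omega>))"
          using comp by (simp add: compact_space_def)
        show "openin (emtop X d \<Omega>) W" if "W \<in> insert (V m) (U ` (X - {p}))" for W
          using that U(1) V(1) by auto
        show "topspace (emtop X d \<Omega>) \<subseteq> \<Union> (insert (V m) (U ` (X - {p})))"
          using U(2) V(2)[of m] unfolding topspace_emtop by fastforce
      qed
      then show ?thesis using that by (auto simp: topspace_emtop)
    qed
    \<comment> \<open>The single set \<open>V m\<close> covers \<open>p\<close>; the remaining
      members of the subcover are small neighbourhoods whose centres form the net.\<close>
    have "finite (F - {V m})" "F - {V m} \<subseteq> U ` (X - {p})"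
      using F by auto
    then obtain C where C: "C \<subseteq> X - {p}" "finite C" "F - {V m} = U ` C"
      using finite_subset_image by metis
    have "\<exists>c\<in>C. mdist p a c < 1 / real (Suc n)" if a: "a \<in> X - {p} - V m" for a
    proof -
      obtain A where "A \<in> F" "a \<in> A" using a F(3) by auto
      then have "A \<in> U ` C" using a C(3) by auto
      then obtain c where "c \<in> C" "a \<in> U c" using \<open>a \<in> A\<close> by auto
      then have "c \<in> C" "mdist p c a < 1 / real (Suc n)" using U(3)[of c a] C a by auto
      moreover have "mdist p c a = mdist p a c"
        by (simp add: mdist_def edist_commute mult.commute)
      ultimately show ?thesis by auto
    qed
    then show ?thesis using C by blast
  qed
  then obtain C where C: "\<And>m n. finite (C m n)" "\<And>m n. C m n \<subseteq> X - {p}"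
    "\<And>m n a. a \<in> X - {p} - V m \<Longrightarrow> \<exists>c\<in>C m n. mdist p a c < 1 / real (Suc n)"
    by metis
  have "\<exists>z\<in>(\<Union>m n. C m n). mdist p w z < e" if w: "w \<in> X - {p}" "e > 0" for w e
  proof -
    obtain n where n: "1 / real (Suc n) < e" using w(2) nat_approx_posE by metis
    obtain m where "w \<notin> V m" using w(1) V(3) by blast
    then obtain z where "z \<in> C m n" "mdist p w z < 1 / real (Suc n)"
      using C(3)[of w m n] w(1) by auto
    with n show ?thesis by (meson UN_I UNIV_I less_trans)
  qed
  moreover have "countable (\<Union>m n. C m n)"
    using C(1) by (intro countable_UN) (auto intro: countable_finite)
  ultimately show ?thesis using that[of "\<Union>m n. C m n"] C(2) by blast
qed

end

section \<open>Circles\<close>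

definition circ :: "real \<Rightarrow> real^2" where
  "circ t = vector [cos t, sin t]"

lemma inner_circ: "circ s \<bullet> circ t = cos (s - t)"
  by (simp add: circ_def inner_vec_def sum_2 cos_diff)

lemma norm_circ [simp]: "norm (circ t) = 1"
  by (simp add: norm_eq_sqrt_inner inner_circ)

lemma continuous_on_circ: "continuous_on S circ"
proof -
  have eq: "circ = (\<lambda>t. \<chi> i. if i = 1 then cos t else sin t)"
    by (auto simp: circ_def vec_eq_iff forall_2)
  have "continuous_on S (\<lambda>t. if i = 1 then cos t else sin t)" for i :: 2
    by (cases "i = 1") (auto intro: continuous_intros)
  then show ?thesis
    unfolding eq by (rule continuous_on_vec_lambda)
qed

text \<open>The starting angle \<open>s\<close> is free, so that any point can be the base point of
  a parametrisation by one full turn.\<close>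

lemma sphere_eq_circ:
  assumes "v \<in> sphere (0 :: real^2) 1"
  obtains t where "0 \<le> t" "t < 2 * pi" "v = circ (s + t)"
proof -
  have "(v $ 1)\<^sup>2 + (v $ 2)\<^sup>2 = 1"
    using assms by (simp add: norm_vec_def L2_set_def sum_2)
  then obtain u where u: "v $ 1 = cos u" "v $ 2 = sin u"
    by (rule sincos_total_2pi)
  define k where "k = \<lfloor>(u - s) / (2 * pi)\<rfloor>"
  define t where "t = u - s - 2 * pi * k"
  have "of_int k \<le> (u - s) / (2 * pi)" "(u - s) / (2 * pi) < of_int k + 1"
    unfolding k_def by linarith+
  then have "0 \<le> t" "t < 2 * pi"
    by (simp_all add: t_def field_simps)
  moreover have "s + t = u + 2 * pi * of_int (- k)" by (simp add: t_def)
  then have "v = circ (s + t)"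
    unfolding vec_eq_iff forall_2 circ_def
    using u sin_cos_eq_iff[of "s + t" u] by (metis vector_2)
  ultimately show ?thesis using that by blast
qed

text \<open>Angles on the complementary arc lie beyond the chord that cuts off the arc of half-width
  \<open>\<delta>\<close>; beyond \<open>pi\<close>, the angle is reflected to
  \<open>2 * pi - \<bar>u\<bar>\<close>.\<close>

lemma cos_less_cos_half_width:
  assumes "0 < \<delta>" "\<delta> < \<bar>u\<bar>" "\<bar>u\<bar> < 2 * pi - \<delta>" "\<delta> < pi"
  shows "cos u < cos \<delta>"
proof (cases "\<bar>u\<bar> \<le> pi")
  case True
  then show ?thesis
    using cos_monotone_0_pi[of \<delta> "\<bar>u\<bar>"] assms by simp
next
  case False
  have "cos (2 * pi - \<bar>u\<bar>) = cos u"
    by (simp add: cos_diff)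
  then show ?thesis
    using cos_monotone_0_pi[of \<delta> "2 * pi - \<bar>u\<bar>"] assms False by simp
qed

lemma cos_half_width_less_cos:
  assumes "\<bar>u\<bar> < \<delta>" "\<delta> < pi"
  shows "cos \<delta> < cos u"
  using cos_monotone_0_pi[of "\<bar>u\<bar>" \<delta>] assms by simp

section \<open>Circles as geodesic lines after inversion\<close>

context extended_ptolemaic
begin

text \<open>One turn of the round circle is transported by the homeomorphism. For
  \<open>r < s < t\<close> the points \<open>c r\<close> and \<open>c t\<close> separate
  \<open>c s\<close> from \<open>c 0 = p\<close>, so the circle equality holds for these four
  points.\<close>

lemma circle_parametrisation:
  assumes circle: "is_circle X d \<Omega> \<sigma>" and p: "p \<in> \<sigma>"
  obtains c where "continuous_map euclideanreal (emtop X d \<Omega>) c" "c 0 = p"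
    "c ` {0<..<2 * pi} = \<sigma> - {p}"
    "\<And>r s t. 0 < r \<Longrightarrow> r < s \<Longrightarrow> s < t \<Longrightarrow> t < 2 * pi \<Longrightarrow>
       edist (c r) (c t) * edist (c s) p =
       edist (c r) (c s) * edist (c t) p + edist (c r) p * edist (c s) (c t)"
proof -
  let ?T = "emtop X d \<Omega>"
  have \<sigma>: "\<sigma> \<subseteq> X" using circle by (simp add: is_circle_def)
  obtain f g where fg: "homeomorphic_maps (subtopology ?T \<sigma>) (top_of_set (sphere (0::real^2) 1)) f g"
    using circle unfolding is_circle_def homeomorphic_space_def by blast
  have top: "topspace (subtopology ?T \<sigma>) = \<sigma>"
    using \<sigma> by (simp add: topspace_emtop Int_absorb1)
  have f: "continuous_map (subtopology ?T \<sigma>) (top_of_set (sphere 0 1)) f"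
    and g: "continuous_map (top_of_set (sphere 0 1)) (subtopology ?T \<sigma>) g"
    and gf: "\<And>v. v \<in> \<sigma> \<Longrightarrow> g (f v) = v"
    and fg': "\<And>u. u \<in> sphere 0 1 \<Longrightarrow> f (g u) = u"
    using fg top by (auto simp: homeomorphic_maps_def)
  have f_in: "f v \<in> sphere 0 1" if "v \<in> \<sigma>" for v
    using continuous_map_funspace[OF f] that top by auto
  obtain t0 where t0: "f p = circ t0"
    using sphere_eq_circ[OF f_in[OF p], of 0] by auto
  define c where "c t = g (circ (t0 + t))" for t
  have fc: "f (c t) = circ (t0 + t)" for t
    unfolding c_def by (intro fg') simp
  have "continuous_map euclideanreal (top_of_set (sphere 0 1)) (\<lambda>t. circ (t0 + t))"
    by (auto simp: continuous_map_in_subtopology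
      intro!: continuous_on_compose2[OF continuous_on_circ] continuous_intros)
  then have cont: "continuous_map euclideanreal (subtopology ?T \<sigma>) c"
    unfolding c_def using continuous_map_compose[OF _ g] by (auto simp: o_def)
  then have c_in: "c t \<in> \<sigma>" for t
    using continuous_map_funspace[OF cont] top by auto
  have c0: "c 0 = p"
    using gf[OF p] t0 by (simp add: c_def)
  have inj: "s = t" if "c s = c t" "s \<in> {0..<2 * pi}" "t \<in> {0..<2 * pi}" for s t
  proof -
    have "circ (t0 + s) = circ (t0 + t)" using that fc by metis
    then have "circ (t0 + s) \<bullet> circ (t0 + t) = 1"
      using norm_circ[of "t0 + t"] by (simp add: inner_circ)
    then have "cos (s - t) = 1" by (simp add: inner_circ)
    then obtain n :: int where "s - t = n * (2 * pi)"
      using cos_one_2pi_int by auto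
    then have "real_of_int n = (s - t) / (2 * pi)" by simp
    moreover have "(s - t) / (2 * pi) < 1" "- 1 < (s - t) / (2 * pi)"
      using that by (auto simp: pos_divide_less_eq pos_less_divide_eq)
    ultimately have "- 1 < real_of_int n" "real_of_int n < 1" by simp_all
    then have "n = 0" by linarith
    then show ?thesis using \<open>s - t = n * (2 * pi)\<close> by simp
  qed
  have surj: "\<exists>t\<in>{0..<2 * pi}. v = c t" if v: "v \<in> \<sigma>" for v
  proof -
    obtain t where "0 \<le> t" "t < 2 * pi" "f v = circ (t0 + t)"
      using sphere_eq_circ[OF f_in[OF v], of t0] by auto
    then show ?thesis using gf[OF v] by (intro bexI[of _ t]) (auto simp: c_def)
  qed
  have img: "c ` {0<..<2 * pi} = \<sigma> - {p}"
  proof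
    show "c ` {0<..<2 * pi} \<subseteq> \<sigma> - {p}"
      using c_in inj[of _ 0] c0 by force
    show "\<sigma> - {p} \<subseteq> c ` {0<..<2 * pi}"
      using surj c0 by (force simp: image_iff)
  qed
  have ptol: "edist (c r) (c t) * edist (c s) p =
      edist (c r) (c s) * edist (c t) p + edist (c r) p * edist (c s) (c t)"
    if rst: "0 < r" "r < s" "s < t" "t < 2 * pi" for r s t
  proof -
    have "c r \<noteq> c s" "c r \<noteq> c t" "c s \<noteq> c t" "c r \<noteq> c 0" "c s \<noteq> c 0" "c t \<noteq> c 0"
      using inj rst by force+
    then have dist: "distinct [c r, c s, c t, p]" "distinct [c r, c t, c s, p]"
      "distinct [c r, p, c s, c t]"
      by (auto simp: c0)
    \<comment> \<open>The chord of the round circle through the images of \<open>c r\<close> and \<open>c t\<close> separates the two arcs.\<close>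
    have sep: "\<not> (\<exists>C\<in>connected_components_of (subtopology ?T (\<sigma> - {c r, c t})). c s \<in> C \<and> p \<in> C)"
    proof clarify
      fix C assume C: "C \<in> connected_components_of (subtopology ?T (\<sigma> - {c r, c t}))"
        "c s \<in> C" "p \<in> C"
      define mid \<delta> where "mid = (r + t) / 2" and "\<delta> = (t - r) / 2"
      have ends: "mid - \<delta> = r" "mid + \<delta> = t"
        by (simp_all add: mid_def \<delta>_def field_simps)
      \<comment> \<open>The height in the direction of the middle of the arc from \<open>c r\<close>
        to \<open>c t\<close>; the chord is the level \<open>cos \<delta>\<close>. A connected
        \<open>C\<close> containing points strictly on both sides meets this level, which only
        \<open>c r\<close> and \<open>c t\<close> attain.\<close>
      define \<psi> where "\<psi> v = f v \<bullet> circ (t0 + mid)" for v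
      have \<psi>c: "\<psi> (c u) = cos (u - mid)" for u
        by (simp add: \<psi>_def fc inner_circ)
      have C': "connectedin ?T C" "C \<subseteq> \<sigma> - {c r, c t}"
        using connectedin_connected_components_of[OF C(1)] by (auto simp: connectedin_subtopology)
      then have "connectedin (subtopology ?T \<sigma>) C"
        by (auto simp: connectedin_subtopology)
      moreover have "continuous_map (subtopology ?T \<sigma>) euclideanreal \<psi>"
      proof -
        have "continuous_map (top_of_set (sphere 0 1)) euclideanreal (\<lambda>v. v \<bullet> circ (t0 + mid))"
          by (auto intro!: continuous_intros)
        moreover have "\<psi> = (\<lambda>v. v \<bullet> circ (t0 + mid)) \<circ> f"
          by (simp add: \<psi>_def fun_eq_iff)
        ultimately show ?thesis
          using continuous_map_compose[OF f] by metis
      qed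
      ultimately have "connected (\<psi> ` C)"
        using connectedin_continuous_map_image[of "subtopology ?T \<sigma>" euclideanreal \<psi> C]
        by (simp only: connectedin_iff_connected)
      moreover have "\<psi> p < cos \<delta>"
        using cos_less_cos_half_width[of \<delta> "0 - mid"] \<psi>c[of 0] c0 ends rst by auto
      moreover have "cos \<delta> < \<psi> (c s)"
        unfolding \<psi>c using ends rst by (intro cos_half_width_less_cos) auto
      ultimately have "cos \<delta> \<in> \<psi> ` C"
        using C connectedD_interval[of "\<psi> ` C" "\<psi> p" "\<psi> (c s)" "cos \<delta>"] by auto
      then obtain v where v: "v \<in> C" "\<psi> v = cos \<delta>" by force
      then obtain u where u: "u \<in> {0..<2 * pi}" "v = c u"
        using surj C' by blast
      have "u \<noteq> r" "u \<noteq> t" using v u C' by auto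
      then have "\<bar>u - mid\<bar> \<noteq> \<delta>" using ends by linarith
      then have "cos (u - mid) \<noteq> cos \<delta>"
        using cos_half_width_less_cos[of "u - mid" \<delta>] cos_less_cos_half_width[of \<delta> "u - mid"]
          ends rst u by fastforce
      then show False using v u \<psi>c by simp
    qed
    have "\<forall>x\<in>\<sigma>. \<forall>y\<in>\<sigma>. \<forall>z\<in>\<sigma>. \<forall>w\<in>\<sigma>. distinct [x, y, z, w] \<longrightarrow>
        \<not> (\<exists>C\<in>connected_components_of (subtopology ?T (\<sigma> - {x, z})). y \<in> C \<and> w \<in> C) \<longrightarrow>
        pprod d \<Omega> x z y w = pprod d \<Omega> x y z w + pprod d \<Omega> x w y z"
      using circle unfolding is_circle_def by (elim conjE)
    from this[rule_format, OF c_in c_in c_in p dist(1) sep]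
    have "pprod d \<Omega> (c r) (c t) (c s) p
        = pprod d \<Omega> (c r) (c s) (c t) p + pprod d \<Omega> (c r) p (c s) (c t)" .
    moreover have "c r \<in> X" "c s \<in> X" "c t \<in> X" "p \<in> X" using c_in p \<sigma> by auto
    ultimately show ?thesis
      by (simp only: pprod_eq_edist[OF _ _ _ _ dist(1)] pprod_eq_edist[OF _ _ _ _ dist(2)]
          pprod_eq_edist[OF _ _ _ _ dist(3)])
        (simp flip: ennreal_plus)
  qed
  show ?thesis
  proof (rule that)
    show "continuous_map euclideanreal ?T c"
      using cont continuous_map_into_fulltopology by blast
  qed (use c0 img ptol in auto)
qed

text \<open>Divided by the three distances to \<open>p\<close>, the circle equality becomes
  additivity of \<open>mdist p\<close> along the parametrisation. The distance from the starting
  point therefore serves as arc length.\<close>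

lemma circle_arc:
  assumes circle: "is_circle X d \<Omega> \<sigma>" and p: "p \<in> \<sigma>" and xy: "x \<in> \<sigma> - {p}" "y \<in> \<sigma> - {p}"
  obtains l where "ptolemaic_space.arc_between (X - {p}) (mdist p) l (mdist p x y) x y"
    "l ` {0..mdist p x y} \<subseteq> \<sigma>"
proof -
  have \<sigma>: "\<sigma> \<subseteq> X" using circle by (simp add: is_circle_def)
  have pX: "p \<in> X" using p \<sigma> by auto
  interpret ptolemaic_space "X - {p}" "mdist p" using ptolemaic_space_mdist[OF pX] .
  obtain c where c: "continuous_map euclideanreal (emtop X d \<Omega>) c" "c 0 = p"
    "c ` {0<..<2 * pi} = \<sigma> - {p}"
    "\<And>r s t. 0 < r \<Longrightarrow> r < s \<Longrightarrow> s < t \<Longrightarrow> t < 2 * pi \<Longrightarrow>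
       edist (c r) (c t) * edist (c s) p =
       edist (c r) (c s) * edist (c t) p + edist (c r) p * edist (c s) (c t)"
    by (rule circle_parametrisation[OF circle p]) (rule that)
  have cX: "c t \<in> X - {p}" if "0 < t" "t < 2 * pi" for t
  proof -
    have "c t \<in> c ` {0<..<2 * pi}" using that by auto
    then show ?thesis using \<sigma> unfolding c(3) by auto
  qed
  have add: "mdist p (c r) (c t) = mdist p (c r) (c s) + mdist p (c s) (c t)"
    if rst: "0 < r" "r \<le> s" "s \<le> t" "t < 2 * pi" for r s t
  proof (cases "r = s \<or> s = t")
    case True
    then show ?thesis using cX rst by auto
  next
    case False
    have "0 < edist (c r) p" "0 < edist (c s) p" "0 < edist (c t) p"
      using cX[of r] cX[of s] cX[of t] rst edist_pos pX by auto
    then have "mdist p (c r) (c t) =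
        (edist (c r) (c t) * edist (c s) p) / (edist (c r) p * edist (c s) p * edist (c t) p)"
      by (simp add: mdist_def)
    also have "edist (c r) (c t) * edist (c s) p =
        edist (c r) (c s) * edist (c t) p + edist (c r) p * edist (c s) (c t)"
      using c(4)[of r s t] rst False by simp
    also have "\<dots> / (edist (c r) p * edist (c s) p * edist (c t) p)
        = mdist p (c r) (c s) + mdist p (c s) (c t)"
      using \<open>0 < edist (c r) p\<close> \<open>0 < edist (c s) p\<close> \<open>0 < edist (c t) p\<close>
      by (simp add: mdist_def add_divide_distrib)
    finally show ?thesis .
  qed
  have main: "\<exists>l. arc_between l (mdist p (c a) (c b)) (c a) (c b) \<and>
      l ` {0..mdist p (c a) (c b)} \<subseteq> \<sigma>" if ab: "0 < a" "a \<le> b" "b < 2 * pi" for a b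
  proof -
    define F where "F t = mdist p (c a) (c t)" for t
    define L where "L = F b"
    have Fd: "mdist p (c s) (c t) = \<bar>F s - F t\<bar>" if "s \<in> {a..b}" "t \<in> {a..b}" for s t
    proof (cases "s \<le> t")
      case True
      then show ?thesis using add[of a s t] that ab nonneg[of "c s" "c t"] by (simp add: F_def)
    next
      case False
      then show ?thesis
        using add[of a t s] that ab nonneg[of "c s" "c t"] by (simp add: F_def commute)
    qed
    have Fa: "F a = 0" using cX[of a] ab by (simp add: F_def)
    \<comment> \<open>Continuity of \<open>c\<close> and \<open>mdist_neighbourhood\<close> make
      \<open>F\<close> continuous, so by the intermediate value theorem it attains every length in
      \<open>{0..L}\<close>.\<close>
    have "continuous_on {a..b} F"
      unfolding continuous_on_iff
    proof (intro ballI allI impI)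
      fix t and e :: real assume t: "t \<in> {a..b}" and e: "e > 0"
      have ct: "c t \<in> X" "c t \<noteq> p" using cX[of t] t ab by auto
      obtain U where U: "openin (emtop X d \<Omega>) U" "c t \<in> U"
        "\<And>v. v \<in> U - {p} \<Longrightarrow> mdist p (c t) v < e"
        using mdist_neighbourhood[OF pX ct e] by metis
      have "openin euclideanreal {u \<in> topspace euclideanreal. c u \<in> U}"
        using openin_continuous_map_preimage[OF c(1) U(1)] .
      then have "open {u. c u \<in> U}" by simp
      then obtain r where r: "r > 0" "\<And>u. dist u t < r \<Longrightarrow> c u \<in> U"
        using U(2) unfolding open_dist by auto
      have "dist (F u) (F t) < e" if u: "u \<in> {a..b}" "dist u t < r" for u
      proof -
        have "mdist p (c t) (c u) < e"
          using U(3) r(2)[OF u(2)] cX[of u] u ab by auto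
        then show ?thesis using Fd[OF t u(1)] by (simp add: dist_real_def abs_minus_commute)
      qed
      then show "\<exists>r>0. \<forall>u\<in>{a..b}. dist u t < r \<longrightarrow> dist (F u) (F t) < e"
        using r(1) by blast
    qed
    then have "\<exists>t. t \<in> {a..b} \<and> F t = s" if "s \<in> {0..L}" for s
      using IVT'[of F a s b] that ab Fa by (auto simp: L_def)
    \<comment> \<open>A right inverse of \<open>F\<close>, the change to arc length. Parameters with
      equal \<open>F\<close> have the same image under \<open>c\<close>, so the endpoints come out
      right.\<close>
    then obtain \<tau> where \<tau>: "\<And>s. s \<in> {0..L} \<Longrightarrow> \<tau> s \<in> {a..b} \<and> F (\<tau> s) = s"
      by metis
    have L: "0 \<le> L" by (simp add: L_def F_def)
    have eq: "c s = c t" if "s \<in> {a..b}" "t \<in> {a..b}" "F s = F t" for s t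
      using Fd[OF that(1,2)] that cX[of s] cX[of t] ab by auto
    have "arc_between (c \<circ> \<tau>) L (c a) (c b)"
      unfolding arc_between_def
    proof (intro conjI ballI)
      have "\<tau> 0 \<in> {a..b} \<and> F (\<tau> 0) = F a" "\<tau> L \<in> {a..b} \<and> F (\<tau> L) = F b"
        using \<tau>[of 0] \<tau>[of L] L Fa unfolding L_def by auto
      then show "(c \<circ> \<tau>) 0 = c a" "(c \<circ> \<tau>) L = c b"
        using eq[of "\<tau> 0" a] eq[of "\<tau> L" b] ab by simp_all
      show "(c \<circ> \<tau>) ` {0..L} \<subseteq> X - {p}"
      proof clarify
        fix s assume "s \<in> {0..L}"
        then have "\<tau> s \<in> {a..b}" using \<tau> by blast
        then show "(c \<circ> \<tau>) s \<in> X - {p}" using cX[of "\<tau> s"] ab by simp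
      qed
      show "mdist p ((c \<circ> \<tau>) s) ((c \<circ> \<tau>) t) = \<bar>s - t\<bar>" if "s \<in> {0..L}" "t \<in> {0..L}" for s t
        using \<tau>[OF that(1)] \<tau>[OF that(2)] Fd by auto
    qed (rule L)
    moreover have "(c \<circ> \<tau>) ` {0..L} \<subseteq> \<sigma>"
    proof -
      have "c t \<in> \<sigma>" if "t \<in> {a..b}" for t
      proof -
        have "c t \<in> c ` {0<..<2 * pi}" using that ab by auto
        then show ?thesis unfolding c(3) by auto
      qed
      then show ?thesis using \<tau> by auto
    qed
    ultimately show ?thesis unfolding L_def F_def by blast
  qed
  obtain a b where ab: "a \<in> {0<..<2 * pi}" "b \<in> {0<..<2 * pi}" "x = c a" "y = c b"
    using xy unfolding c(3)[symmetric] by blast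
  show ?thesis
  proof (cases "a \<le> b")
    case True
    then show ?thesis using main[of a b] ab that by auto
  next
    case False
    then have "b \<le> a" by simp
    then obtain l where "arc_between l (mdist p y x) y x" "l ` {0..mdist p y x} \<subseteq> \<sigma>"
      using main[of b a] ab by (metis greaterThanLessThan_iff)
    then have l: "arc_between l (mdist p x y) y x" "l ` {0..mdist p x y} \<subseteq> \<sigma>"
      unfolding commute[of y x] .
    have "arc_between (\<lambda>t. l (mdist p x y - t)) (mdist p x y) x y"
      using arc_between_reverse[OF l(1)] .
    moreover have "(\<lambda>t. l (mdist p x y - t)) ` {0..mdist p x y} \<subseteq> \<sigma>"
      using l(2) by (auto simp: image_subset_iff)
    ultimately show ?thesis using that by blast
  qed
qed

text \<open>Starting from \<open>p\<close>, one of \<open>x\<close>, \<open>y\<close>,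
  \<open>z\<close> comes second of the three; the other two separate it from \<open>p\<close>. The
  six possible orders pair up by reversal into the three equalities.\<close>

lemma circle_four_points:
  assumes circle: "is_circle X d \<Omega> \<sigma>"
    and in_circle: "p \<in> \<sigma>" "x \<in> \<sigma> - {p}" "y \<in> \<sigma> - {p}" "z \<in> \<sigma> - {p}"
    and distinct: "distinct [x, y, z]"
  shows "edist x y * edist p z = edist p x * edist y z + edist p y * edist x z \<or>
    edist y z * edist p x = edist p y * edist x z + edist p z * edist x y \<or>
    edist x z * edist p y = edist p x * edist y z + edist p z * edist x y"
proof -
  obtain c where c: "c ` {0<..<2 * pi} = \<sigma> - {p}"
    "\<And>r s t. 0 < r \<Longrightarrow> r < s \<Longrightarrow> s < t \<Longrightarrow> t < 2 * pi \<Longrightarrow>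
       edist (c r) (c t) * edist (c s) p =
       edist (c r) (c s) * edist (c t) p + edist (c r) p * edist (c s) (c t)"
    using circle_parametrisation[OF circle in_circle(1)] by metis
  obtain r s t where *: "r \<in> {0<..<2 * pi}" "s \<in> {0<..<2 * pi}" "t \<in> {0<..<2 * pi}"
    "x = c r" "y = c s" "z = c t"
    using in_circle unfolding c(1)[symmetric] by blast
  have "r \<noteq> s" "r \<noteq> t" "s \<noteq> t" using distinct * by auto
  then consider "r < s" "s < t" | "r < t" "t < s" | "s < r" "r < t" | "s < t" "t < r"
    | "t < r" "r < s" | "t < s" "s < r"
    by linarith
  then show ?thesis
    using c(2)[of r s t] c(2)[of r t s] c(2)[of s r t] c(2)[of s t r] c(2)[of t r s] c(2)[of t s r] *
    by cases (auto simp: edist_commute mult.commute add.commute)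
qed

text \<open>After inversion at the common point \<open>u\<close>, the hypothesis
  \<open>between\<close> says that \<open>p\<close> lies metrically between \<open>x\<close> and
  \<open>y\<close>. A geodesic from \<open>x\<close> through \<open>p\<close> to \<open>y\<close>
  must then agree with the one contained in \<open>\<tau>\<close>.\<close>

lemma between_in_both_circles:
  assumes comp: "compact_space (emtop X d \<Omega>)"
    and circles: "\<forall>x\<in>X. \<forall>y\<in>X. \<forall>z\<in>X. \<exists>\<sigma>. is_circle X d \<Omega> \<sigma> \<and> {x, y, z} \<subseteq> \<sigma>"
    and \<sigma>: "is_circle X d \<Omega> \<sigma>" and \<tau>: "is_circle X d \<Omega> \<tau>"
    and u: "u \<in> \<sigma> \<inter> \<tau>" and xy: "x \<in> \<sigma> \<inter> \<tau> - {u}" "y \<in> \<sigma> \<inter> \<tau> - {u}" and p: "p \<in> \<sigma> - {u}"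
    and between: "edist x y * edist p u = edist x p * edist y u + edist p y * edist x u"
  shows "p \<in> \<tau>"
proof -
  have \<sigma>X: "\<sigma> \<subseteq> X" using \<sigma> by (simp add: is_circle_def)
  then have uX: "u \<in> X" using u by auto
  interpret ptolemaic_space "X - {u}" "mdist u" using ptolemaic_space_mdist[OF uX] .
  obtain Q where Q: "countable Q" "Q \<subseteq> X - {u}"
    "\<And>w e. w \<in> X - {u} \<Longrightarrow> e > 0 \<Longrightarrow> \<exists>z\<in>Q. mdist u w z < e"
    by (rule separable_mdist[OF comp uX]) (rule that)
  \<comment> \<open>A circle through \<open>a\<close>, \<open>b\<close> and \<open>u\<close>
    contains a geodesic from \<open>a\<close> to \<open>b\<close> for the metric inverted at
    \<open>u\<close>; its middle point is the required midpoint.\<close>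
  have mid: "\<exists>w\<in>X - {u}. mdist u a w = mdist u a b / 2 \<and> mdist u w b = mdist u a b / 2"
    if ab: "a \<in> X - {u}" "b \<in> X - {u}" for a b
  proof -
    obtain \<rho> where \<rho>: "is_circle X d \<Omega> \<rho>" "{a, b, u} \<subseteq> \<rho>"
      using circles ab uX by blast
    obtain l where l: "arc_between l (mdist u a b) a b"
    proof (rule circle_arc[OF \<rho>(1)])
      show "u \<in> \<rho>" "a \<in> \<rho> - {u}" "b \<in> \<rho> - {u}" using \<rho>(2) ab by auto
    qed (rule that)
    define h where "h = mdist u a b / 2"
    have h: "h \<in> {0..mdist u a b}" "0 \<in> {0..mdist u a b}" "mdist u a b \<in> {0..mdist u a b}"
      by (auto simp: h_def)
    have ends: "l 0 = a" "l (mdist u a b) = b" and lM: "l ` {0..mdist u a b} \<subseteq> X - {u}"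
      and dl: "\<forall>s\<in>{0..mdist u a b}. \<forall>t\<in>{0..mdist u a b}. mdist u (l s) (l t) = \<bar>s - t\<bar>"
      using l by (simp_all add: arc_between_def)
    have "mdist u a (l h) = h" "mdist u (l h) b = h"
      using dl[rule_format, OF h(2,1)] dl[rule_format, OF h(1,3)] h unfolding ends
      by (simp_all add: h_def)
    moreover have "l h \<in> X - {u}" using lM h(1) by blast
    ultimately show ?thesis unfolding h_def by blast
  qed
  have "0 < edist x u" "0 < edist y u" "0 < edist p u"
    using edist_pos xy p \<sigma>X uX by auto
  then have "mdist u x y = (edist x y * edist p u) / (edist x u * edist y u * edist p u)"
    by (simp add: mdist_def)
  also have "\<dots> = mdist u x p + mdist u p y"
    unfolding between using \<open>0 < edist x u\<close> \<open>0 < edist y u\<close> \<open>0 < edist p u\<close>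
    by (simp add: mdist_def add_divide_distrib mult.commute)
  finally have sum: "mdist u x y = mdist u x p + mdist u p y" .
  have in_\<sigma>: "u \<in> \<sigma>" "x \<in> \<sigma> - {u}" "y \<in> \<sigma> - {u}"
    and in_\<tau>: "u \<in> \<tau>" "x \<in> \<tau> - {u}" "y \<in> \<tau> - {u}"
    using u xy by auto
  obtain l1 where l1: "arc_between l1 (mdist u x p) x p"
    by (rule circle_arc[OF \<sigma> in_\<sigma>(1,2) p]) (rule that)
  obtain l2 where l2: "arc_between l2 (mdist u p y) p y"
    by (rule circle_arc[OF \<sigma> in_\<sigma>(1) p in_\<sigma>(3)]) (rule that)
  obtain m where m: "arc_between m (mdist u x y) x y" "m ` {0..mdist u x y} \<subseteq> \<tau>"
    by (rule circle_arc[OF \<tau> in_\<tau>]) (rule that)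
  \<comment> \<open>By \<open>sum\<close> the two arcs through \<open>p\<close> join to a geodesic,
    which passes through \<open>p\<close> at parameter \<open>mdist u x p\<close>.\<close>
  define l where "l t = (if t \<le> mdist u x p then l1 t else l2 (t - mdist u x p))" for t
  have l: "arc_between l (mdist u x y) x y"
    using arc_between_join[OF l1 l2 sum] unfolding l_def[abs_def] sum .
  have s: "mdist u x p \<in> {0..mdist u x y}" by (simp add: sum)
  have "p = l (mdist u x p)" using l1 by (simp add: l_def arc_between_def)
  also have "\<dots> = m (mdist u x p)" using arc_between_unique[OF Q mid l m(1) s] .
  finally show ?thesis using m(2) s by auto
qed

text \<open>Each of the three equalities singles out the point among \<open>x\<close>,
  \<open>y\<close>, \<open>z\<close> that the other two separate from \<open>p\<close>; this is the
  centre at which to invert.\<close>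

lemma circle_subset:
  assumes comp: "compact_space (emtop X d \<Omega>)"
    and circles: "\<forall>x\<in>X. \<forall>y\<in>X. \<forall>z\<in>X. \<exists>\<sigma>. is_circle X d \<Omega> \<sigma> \<and> {x, y, z} \<subseteq> \<sigma>"
    and \<sigma>: "is_circle X d \<Omega> \<sigma>" and \<tau>: "is_circle X d \<Omega> \<tau>"
    and xyz: "{x, y, z} \<subseteq> \<sigma> \<inter> \<tau>" "distinct [x, y, z]"
  shows "\<sigma> \<subseteq> \<tau>"
proof
  fix p assume p: "p \<in> \<sigma>"
  note in_both = between_in_both_circles[OF comp circles \<sigma> \<tau>]
  show "p \<in> \<tau>"
  proof (cases "p \<in> {x, y, z}")
    case True
    then show ?thesis using xyz by auto
  next
    case False
    then have "edist x y * edist p z = edist p x * edist y z + edist p y * edist x z \<or>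
        edist y z * edist p x = edist p y * edist x z + edist p z * edist x y \<or>
        edist x z * edist p y = edist p x * edist y z + edist p z * edist x y"
      using xyz p by (intro circle_four_points[OF \<sigma>]) auto
    then show ?thesis
      using in_both[of z x y p] in_both[of x y z p] in_both[of y x z p] xyz p False
      by (auto simp: edist_commute mult.commute)
  qed
qed

end

theorem theorem2p4:
  fixes X :: "'a set" and d :: "'a \<Rightarrow> 'a \<Rightarrow> ennreal" and \<Omega> :: "'a set"
  assumes "ext_metric X d \<Omega>"
    and "compact_space (emtop X d \<Omega>)"
    and "ptolemy X d \<Omega>"
    and "\<forall>x\<in>X. \<forall>y\<in>X. \<forall>z\<in>X. \<exists>\<sigma>. is_circle X d \<Omega> \<sigma> \<and> {x, y, z} \<subseteq> \<sigma>"
  shows "\<forall>x\<in>X. \<forall>y\<in>X. \<forall>z\<in>X. distinct [x, y, z] \<longrightarrow>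
           (\<exists>!\<sigma>. is_circle X d \<Omega> \<sigma> \<and> {x, y, z} \<subseteq> \<sigma>)"
proof (intro ballI impI ex_ex1I)
  interpret extended_ptolemaic X d \<Omega>
    using assms(1,3) by unfold_locales
  fix x y z assume xyz: "x \<in> X" "y \<in> X" "z \<in> X" "distinct [x, y, z]"
  show "\<exists>\<sigma>. is_circle X d \<Omega> \<sigma> \<and> {x, y, z} \<subseteq> \<sigma>"
    using assms(4) xyz by blast
  fix \<sigma> \<tau>
  assume "is_circle X d \<Omega> \<sigma> \<and> {x, y, z} \<subseteq> \<sigma>" "is_circle X d \<Omega> \<tau> \<and> {x, y, z} \<subseteq> \<tau>"
  then show "\<sigma> = \<tau>"
    using circle_subset[OF assms(2,4)] xyz(4) by (metis Int_subset_iff subset_antisym)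
qed

end
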